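(* Let $p\ge 1$ be an integer and let $f(z)=z^p+\sum_{n=p+1}^\infty a_nz^n$ be analytic in $\mathbb D$. Assume that $$\left|\arg\{f^{(p)}(z)\}\right|<\frac{\pi\alpha_0}{2}\quad\text{for all } z\in\mathbb D$$ for some $\alpha_0\in(0,3/2]$, and let the sequence $\{\alpha_k\}_{k=1}^{p}$ be defined recursively by $$\alpha_k+\frac{2}{\pi}\tan^{-1}\frac{\alpha_k}{k}=\alpha_{k-1},\quad k\in\{1,\ldots,p\}.$$ Then $$\left|\arg\left\{\frac{zf^{(p-s+1)}(z)}{f^{(p-s)}(z)}\right\}\right|<\frac{\pi}{2}(\alpha_s+\alpha_{s-1})\quad\text{for all } z\in\mathbb D$$ for all $s\in\{2,\ldots,p\}$. Furthermore, if there exists a positive integer $\sigma\in\{2,\ldots,p\}$ such that $\alpha_\sigma+\alpha_{\sigma-1}\leq 1$, then $$\left|\arg\left\{\frac{zf'(z)}{f(z)}\right\}\right|<\frac{\pi(\alpha_{p-1}+\alpha_p)}{2}\leq\frac{\pi}{2}\quad\text{for all } z\in\mathbb D,$$ that is, $f$ is $p$-valently strongly starlike of order $\alpha_{p-1}+\alpha_p$.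
   Context: $\mathbb D=\{z\in\mathbb C:|z|<1\}$. $f^{(j)}$ is the $j$-th derivative of $f$, with $f^{(0)}=f$. Quotients such as $zf^{(p-s+1)}(z)/f^{(p-s)}(z)$ are understood at $z=0$ by their (removable-singularity) analytic extension. $\arg$ denotes the principal argument; a statement $|\arg w|<c$ includes that $w$ is well defined and $w\neq 0$. Each $\alpha_k$ is the unique real solution $x$ of $x+\frac{2}{\pi}\tan^{-1}\frac{x}{k}=\alpha_{k-1}$ (it is positive since $\alpha_{k-1}>0$). For $0<\alpha\le 1$, a function $f(z)=z^p+\sum_{n=p+1}^\infty a_nz^n$ analytic in $\mathbb D$ is $p$-valently strongly starlike of order $\alpha$ if $\left|\arg\{zf'(z)/f(z)\}\right|<\alpha\pi/2$ for all $z\in\mathbb D$. *)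

theory Defs
  imports "HOL-Complex_Analysis.Complex_Analysis"
begin

definition pvalent_normalized :: "nat \<Rightarrow> (complex \<Rightarrow> complex) \<Rightarrow> bool" where
  "pvalent_normalized p f \<longleftrightarrow>
     f holomorphic_on ball 0 1 \<and>
     (\<exists>a :: nat \<Rightarrow> complex. \<forall>z\<in>ball 0 1.
        (\<lambda>n. a (p + 1 + n) * z ^ (p + 1 + n)) sums (f z - z ^ p))"

(* The library sets Arg 0 = 0, so a bound on |arg w| must state w \<noteq> 0 separately. *)
definition abs_arg_less :: "complex \<Rightarrow> real \<Rightarrow> bool" where
  "abs_arg_less w c \<longleftrightarrow> w \<noteq> 0 \<and> \<bar>Arg w\<bar> < c"

(* Division by 0 is 0 in HOL. A quotient that is genuinely undefined is excluded by
   ext_quotient_defined: the denominator must not vanish at z, except that at the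
   origin a removable singularity of g / h suffices. *)
definition ext_quotient_defined ::
    "(complex \<Rightarrow> complex) \<Rightarrow> (complex \<Rightarrow> complex) \<Rightarrow> complex \<Rightarrow> bool" where
  "ext_quotient_defined g h z \<longleftrightarrow>
     (if z = 0
      then \<exists>q. q analytic_on {0} \<and> (\<forall>\<^sub>F w in at 0. h w \<noteq> 0 \<and> q w = g w / h w)
      else h z \<noteq> 0)"

definition ext_quotient ::
    "(complex \<Rightarrow> complex) \<Rightarrow> (complex \<Rightarrow> complex) \<Rightarrow> complex \<Rightarrow> complex" where
  "ext_quotient g h z = (if z = 0 then remove_sings (\<lambda>w. g w / h w) 0 else g z / h z)"

definition abs_arg_quotient_less ::
    "(complex \<Rightarrow> complex) \<Rightarrow> (complex \<Rightarrow> complex) \<Rightarrow> complex \<Rightarrow> real \<Rightarrow> bool" where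
  "abs_arg_quotient_less g h z c \<longleftrightarrow>
     ext_quotient_defined g h z \<and> abs_arg_less (ext_quotient g h z) c"

definition strongly_starlike :: "nat \<Rightarrow> real \<Rightarrow> (complex \<Rightarrow> complex) \<Rightarrow> bool" where
  "strongly_starlike p \<alpha> f \<longleftrightarrow>
     0 < \<alpha> \<and> \<alpha> \<le> 1 \<and> pvalent_normalized p f \<and>
     (\<forall>z\<in>ball 0 1. abs_arg_quotient_less (\<lambda>w. w * deriv f w) f z (\<alpha> * pi / 2))"

end

theory Submission
  imports Defs
begin

text \<open>
  Write \<open>f\<^sup>(\<^sup>p\<^sup>-\<^sup>k\<^sup>) = z\<^sup>k F\<^sub>k\<close>. Then \<open>F\<^sub>k\<^sub>-\<^sub>1 = k F\<^sub>k + z F\<^sub>k'\<close>, and the quotient to be bounded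
  is \<open>F\<^sub>s\<^sub>-\<^sub>1 / F\<^sub>s\<close>, so it suffices to show \<open>|arg F\<^sub>k| < \<pi>\<alpha>\<^sub>k/2\<close> by induction on \<open>k\<close>.
  Suppose that \<open>F\<^sub>k\<close> leaves its sector, and let \<open>y\<close> be a point of least modulus where it does.
  If \<open>F\<^sub>k(y)\<close> lies on an edge of the sector, Jack's lemma for the power \<open>F\<^sub>k\<close> to the
  \<open>1/\<alpha>\<^sub>k\<close> gives \<open>y F\<^sub>k'(y) / F\<^sub>k(y) = \<plusminus>i\<alpha>\<^sub>kM\<close> with \<open>M \<ge> 1\<close>, and then the argument of \<open>F\<^sub>k\<^sub>-\<^sub>1(y)\<close> is
  at least \<open>\<pi>\<alpha>\<^sub>k/2 + arctan(\<alpha>\<^sub>k/k) = \<pi>\<alpha>\<^sub>k\<^sub>-\<^sub>1/2\<close> in modulus. If \<open>F\<^sub>k(y) = 0\<close>, the image under \<open>F\<^sub>k\<close> of the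
  disc of radius \<open>|y|\<close> fills, to first order at \<open>0\<close>, a half-plane with inner normal
  \<open>- F\<^sub>k\<^sub>-\<^sub>1(y)\<close>, which fits into the sector only if \<open>|arg F\<^sub>k\<^sub>-\<^sub>1(y)| \<ge> 3\<pi>/2 - \<pi>\<alpha>\<^sub>k/2\<close>. In both cases \<open>\<alpha>\<^sub>k + \<alpha>\<^sub>k\<^sub>-\<^sub>1 \<le> 3\<close>, a consequence of \<open>\<alpha>\<^sub>0 \<le> 3/2\<close>, keeps the
  argument from wrapping around.
\<close>

section \<open>Boundary derivatives of holomorphic maps: Jack's lemma and its half-plane
  form\<close>

lemma eventually_inward_in_ball:
  fixes z u :: complex
  assumes "z \<noteq> 0" "Re u < 0"
  shows "\<forall>\<^sub>F t in at_right 0. z * (1 + of_real t * u) \<in> ball 0 (cmod z)"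
proof -
  have "u \<noteq> 0" using assms by auto
  \<comment> \<open>The positive root in \<open>t\<close> of |1 + t u|^2 - 1 = 2 t Re u + t^2
    |u|^2.\<close>
  define d where "d = - 2 * Re u / (cmod u)\<^sup>2"
  have "d > 0" using assms \<open>u \<noteq> 0\<close> by (simp add: d_def divide_neg_pos)
  then have "\<forall>\<^sub>F t in at_right 0. t \<in> {0<..<d}"
    by (rule eventually_at_right_real)
  then show ?thesis
  proof eventually_elim
    case (elim t)
    have "t * (cmod u)\<^sup>2 < - 2 * Re u"
      using elim \<open>u \<noteq> 0\<close> by (simp add: d_def field_simps)
    then have "t * (t * (cmod u)\<^sup>2) < t * (- 2 * Re u)"
      using elim by (intro mult_strict_left_mono) auto
    moreover have "(cmod (1 + of_real t * u))\<^sup>2 = 1 + 2 * t * Re u + t * (t * (cmod u)\<^sup>2)"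
      by (simp add: cmod_power2) (simp add: power2_eq_square algebra_simps)
    ultimately have "(cmod (1 + of_real t * u))\<^sup>2 < 1\<^sup>2" by (simp add: mult.commute mult.left_commute)
    then have "cmod (1 + of_real t * u) < 1" by (rule power_less_imp_less_base) simp
    then show ?case using assms by (simp add: norm_mult)
  qed
qed

lemma directional_difference_quotient_tendsto:
  fixes h :: "complex \<Rightarrow> complex"
  assumes "(h has_field_derivative D) (at z)"
  shows "((\<lambda>t. (h (z * (1 + of_real t * u)) - h z) / of_real t) \<longlongrightarrow> z * D * u) (at_right 0)"
proof -
  have "((\<lambda>s. z * (1 + s * u)) has_field_derivative z * u) (at 0)"
    by (auto intro!: derivative_eq_intros)
  from DERIV_chain2[OF _ this, of h D] assms
  have "((\<lambda>s. h (z * (1 + s * u))) has_field_derivative D * (z * u)) (at 0)"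
    by simp
  then have "((\<lambda>s. (h (z * (1 + s * u)) - h z) / s) \<longlongrightarrow> D * (z * u)) (at 0)"
    by (simp add: DERIV_def)
  moreover have "filterlim (\<lambda>t::real. complex_of_real t) (at 0) (at_right 0)"
    by (rule filterlim_atI)
       (auto intro!: tendsto_eq_intros simp: eventually_at_filter)
  ultimately have "((\<lambda>t. (h (z * (1 + of_real t * u)) - h z) / of_real t)
      \<longlongrightarrow> D * (z * u)) (at_right 0)"
    by (rule filterlim_compose)
  then show ?thesis by (simp add: mult_ac)
qed

text \<open>Only inward directions are used, so \<open>\<phi>\<close> need not be defined on the rest of the circle.\<close>

lemma Jack_boundary:
  fixes \<phi> :: "complex \<Rightarrow> complex"
  assumes z: "z \<noteq> 0" and hol: "\<phi> holomorphic_on ball 0 (cmod z)" and "\<phi> 0 = 0"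
    and le1: "\<And>w. cmod w < cmod z \<Longrightarrow> cmod (\<phi> w) < 1"
    and der: "(\<phi> has_field_derivative D) (at z)" and nrm: "cmod (\<phi> z) = 1"
  obtains m :: real where "m \<ge> 1" "z * D = of_real m * \<phi> z"
proof -
  let ?r = "cmod z"
  have r: "?r > 0" using z by simp
  have Schwarz: "cmod (\<phi> w) \<le> cmod w / ?r" if "cmod w < ?r" for w
  proof -
    define \<psi> where "\<psi> = (\<lambda>w. \<phi> (of_real ?r * w))"
    have sub: "(\<lambda>w. complex_of_real ?r * w) ` ball 0 1 \<subseteq> ball 0 ?r"
      using r by (auto simp: norm_mult)
    have "\<psi> holomorphic_on ball 0 1"
      unfolding \<psi>_def
      using holomorphic_on_compose_gen[OF _ hol sub] by (auto simp: o_def intro!: holomorphic_intros)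
    moreover have "\<psi> 0 = 0" using assms by (simp add: \<psi>_def)
    moreover have "cmod (\<psi> w) < 1" if "cmod w < 1" for w
      using that r le1 by (simp add: \<psi>_def norm_mult)
    moreover have "cmod (w / of_real ?r) < 1" using that r by (simp add: norm_divide)
    ultimately have "cmod (\<psi> (w / of_real ?r)) \<le> cmod (w / of_real ?r)"
      using Schwarz_Lemma(1) by blast
    then show ?thesis using r by (simp add: \<psi>_def norm_divide)
  qed
  \<comment> \<open>Conjugation inverts the unimodular number \<open>\<phi> z\<close>, so
    \<open>X\<close> is z D / \<phi>(z), which has to be real and at least 1.\<close>
  define X where "X = z * D * cnj (\<phi> z)"
  have unit: "\<phi> z * cnj (\<phi> z) = 1" using nrm by (simp add: complex_norm_square[symmetric])
  \<comment> \<open>With v = 1 + t u, the real part of \<phi>(z v) times the conjugate of \<phi>(z)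
    is at most |v| by \<open>Schwarz\<close>; expanding in \<open>t\<close> and comparing
    first-order terms gives the bound.\<close>
  have dir: "Re (X * u) \<le> Re u" if u: "Re u < 0" for u
  proof (rule tendsto_le)
    have "((\<lambda>t. Re ((\<phi> (z * (1 + of_real t * u)) - \<phi> z) / of_real t * cnj (\<phi> z)))
        \<longlongrightarrow> Re (z * D * u * cnj (\<phi> z))) (at_right 0)"
      by (intro tendsto_intros directional_difference_quotient_tendsto der)
    then show "((\<lambda>t. Re ((\<phi> (z * (1 + of_real t * u)) - \<phi> z) / of_real t * cnj (\<phi> z)))
        \<longlongrightarrow> Re (X * u)) (at_right 0)" by (simp add: X_def mult_ac)
    have "((\<lambda>t. Re u + t * ((cmod u)\<^sup>2 / 2)) \<longlongrightarrow> Re u + 0 * ((cmod u)\<^sup>2 / 2)) (at_right 0)"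
      by (intro tendsto_intros)
    then show "((\<lambda>t. Re u + t * ((cmod u)\<^sup>2 / 2)) \<longlongrightarrow> Re u) (at_right 0)" by simp
    show "\<forall>\<^sub>F t in at_right 0. Re ((\<phi> (z * (1 + of_real t * u)) - \<phi> z) / of_real t * cnj (\<phi> z))
        \<le> Re u + t * ((cmod u)\<^sup>2 / 2)"
      using eventually_inward_in_ball[OF z u] eventually_at_right_less[of 0]
    proof eventually_elim
      case (elim t)
      let ?v = "1 + of_real t * u"
      have "Re (\<phi> (z * ?v) * cnj (\<phi> z)) \<le> cmod (\<phi> (z * ?v) * cnj (\<phi> z))"
        by (rule complex_Re_le_cmod)
      also have "\<dots> = cmod (\<phi> (z * ?v))" using nrm by (simp add: norm_mult)
      also have "\<dots> \<le> cmod (z * ?v) / ?r" using elim Schwarz[of "z * ?v"] by simp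
      also have "\<dots> = cmod ?v" using r by (simp add: norm_mult)
      also have "\<dots> \<le> (1 + (cmod ?v)\<^sup>2) / 2"
        using arith_geo_mean_sqrt[of 1 "(cmod ?v)\<^sup>2"] by simp
      also have "(cmod ?v)\<^sup>2 = 1 + 2 * t * Re u + t\<^sup>2 * (cmod u)\<^sup>2"
        by (simp add: cmod_power2) (simp add: power2_eq_square algebra_simps)
      finally have "Re (\<phi> (z * ?v) * cnj (\<phi> z)) - 1 \<le> t * (Re u + t * ((cmod u)\<^sup>2 / 2))"
        by (simp add: power2_eq_square field_simps)
      moreover have "Re ((\<phi> (z * ?v) - \<phi> z) / of_real t * cnj (\<phi> z))
          = (Re (\<phi> (z * ?v) * cnj (\<phi> z)) - 1) / t"
      proof -
        have "(\<phi> (z * ?v) - \<phi> z) / of_real t * cnj (\<phi> z) = (\<phi> (z * ?v) * cnj (\<phi> z) - 1) / of_real t"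
          using unit by (simp add: algebra_simps diff_divide_distrib)
        then show ?thesis by (simp only: Re_divide_of_real minus_complex.sel one_complex.sel)
      qed
      ultimately show ?case using elim by (simp add: pos_divide_le_eq mult.commute)
    qed
  qed simp
  have "Re X \<ge> 1" using dir[of "-1"] by simp
  moreover have "Im X = 0"
  proof -
    \<comment> \<open>The nearly tangential directions -e + i and -e - i bound Im X from both
      sides.\<close>
    have a: "\<bar>Im X\<bar> \<le> e * (Re X - 1)" if "e > 0" for e
      using that dir[of "Complex (-e) 1"] dir[of "Complex (-e) (-1)"]
      by (simp add: algebra_simps abs_le_iff)
    have "((\<lambda>e. e * (Re X - 1)) \<longlongrightarrow> 0 * (Re X - 1)) (at_right 0)"
      by (intro tendsto_intros)
    moreover have "\<forall>\<^sub>F e in at_right 0. \<bar>Im X\<bar> \<le> e * (Re X - 1)"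
      using eventually_at_right_less[of 0] by eventually_elim (rule a)
    ultimately have "\<bar>Im X\<bar> \<le> 0 * (Re X - 1)"
      by (intro tendsto_lowerbound[of _ _ "at_right 0"]) auto
    then show ?thesis by simp
  qed
  moreover have "z * D = X * \<phi> z" using unit by (simp add: X_def mult_ac)
  ultimately show ?thesis using that[of "Re X"] by (simp add: complex_eq_iff)
qed

text \<open>The Cayley transform (g - 1)/(g + 1) maps the right half-plane to the unit disc and the
  imaginary axis to the unit circle, so Jack's lemma applies to it. Its logarithmic derivative is 2
  g'/(g^2 - 1), and g(z)^2 - 1 = -(1 + a^2).\<close>

lemma Caratheodory_boundary:
  fixes g :: "complex \<Rightarrow> complex"
  assumes z: "z \<noteq> 0" and hol: "g holomorphic_on ball 0 (cmod z)" and g0: "g 0 = 1"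
    and pos: "\<And>w. cmod w < cmod z \<Longrightarrow> Re (g w) > 0"
    and der: "(g has_field_derivative D) (at z)" and gz: "g z = \<i> * of_real a"
  obtains m :: real where "m \<ge> 1" "z * D = - of_real (m * (1 + a\<^sup>2) / 2)"
proof -
  define \<phi> where "\<phi> = (\<lambda>w. (g w - 1) / (g w + 1))"
  have ne: "g w + 1 \<noteq> 0" if "Re (g w) \<ge> 0" for w
    using that by (auto simp: complex_eq_iff)
  have gz1: "g z + 1 \<noteq> 0" using gz by (intro ne) simp
  have nz: "cmod (g z - 1) = cmod (g z + 1)" using gz by (simp add: cmod_def)
  obtain m where m: "m \<ge> 1"
    "z * ((D * (g z + 1) - (g z - 1) * D) / ((g z + 1) * (g z + 1))) = of_real m * \<phi> z"
  proof (rule Jack_boundary[OF z, of \<phi>])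
    show "\<phi> holomorphic_on ball 0 (cmod z)"
      unfolding \<phi>_def using ne pos by (intro holomorphic_intros hol) (auto simp: less_imp_le)
    show "\<phi> 0 = 0" using g0 by (simp add: \<phi>_def)
    show "(\<phi> has_field_derivative (D * (g z + 1) - (g z - 1) * D) / ((g z + 1) * (g z + 1))) (at z)"
      unfolding \<phi>_def using gz1 by (auto intro!: derivative_eq_intros der)
    show "cmod (\<phi> z) = 1" using nz gz1 by (simp add: \<phi>_def norm_divide)
    show "cmod (\<phi> w) < 1" if "cmod w < cmod z" for w
    proof -
      have "(cmod (g w - 1))\<^sup>2 < (cmod (g w + 1))\<^sup>2"
        using pos[OF that] by (simp add: cmod_power2) (simp add: power2_eq_square algebra_simps)
      then have "cmod (g w - 1) < cmod (g w + 1)" by (rule power_less_imp_less_base) simp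
      then show ?thesis using ne[of w] pos[OF that] by (simp add: \<phi>_def norm_divide)
    qed
  qed auto
  have "z * D * 2 = of_real m * (g z - 1) * (g z + 1)"
    using m(2) gz1 by (simp add: \<phi>_def divide_simps split: if_splits) (simp add: algebra_simps)
  also have "\<dots> = of_real m * (g z * g z - 1)" by (simp add: algebra_simps)
  also have "g z * g z = - (of_real a)\<^sup>2" using gz by (simp add: power2_eq_square algebra_simps)
  finally have "z * D = - of_real (m * (1 + a\<^sup>2) / 2)"
    by (simp add: field_simps) (simp add: eq_neg_iff_add_eq_0 add_ac)
  then show ?thesis using that m(1) by blast
qed

section \<open>Sectors, and the first exit of a holomorphic function from one\<close>

text \<open>Cosine decreases on [0, pi]. The inequality on the right is between continuous functions
  of \<open>w\<close>, unlike \<open>Arg\<close>, so it passes to limits; its strictness already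
  excludes 0.\<close>

lemma abs_arg_less_iff_sector:
  assumes "0 < \<beta>" "\<beta> \<le> pi"
  shows "abs_arg_less w \<beta> \<longleftrightarrow> cmod w * cos \<beta> < Re w"
proof (cases "w = 0")
  case False
  have "Re w = cmod w * cos (Arg w)" using Re_rcis[of "cmod w" "Arg w"] rcis_cmod_Arg by simp
  also have "cos (Arg w) = cos \<bar>Arg w\<bar>" by simp
  finally have "cmod w * cos \<beta> < Re w \<longleftrightarrow> cos \<beta> < cos \<bar>Arg w\<bar>" using False by simp
  also have "\<dots> \<longleftrightarrow> \<bar>Arg w\<bar> < \<beta>"
    using assms Arg_bounded[of w] by (intro cos_mono_less_eq) auto
  finally show ?thesis using False by (simp add: abs_arg_less_def)
qed (simp add: abs_arg_less_def)

text \<open>Difference quotients along inward directions put the half-plane of all D u with Re u <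
  0, where D = z F'(z), into the closed sector. Its edges force |Re D| >= |D| sin \<beta>; the bound
  by \<gamma> <= 3 pi/2 - \<beta> then makes Re D positive, and an inward direction leads to the
  negative axis.\<close>

lemma sector_boundary_zero_contradiction:
  fixes F :: "complex \<Rightarrow> complex"
  assumes z: "z \<noteq> 0" and der: "(F has_field_derivative F') (at z)" and Fz: "F z = 0"
    and ins: "\<And>w. cmod w < cmod z \<Longrightarrow> cmod (F w) * cos \<beta> < Re (F w)"
    and D: "cmod (z * F') * cos \<gamma> < Re (z * F')"
    and \<beta>: "0 < \<beta>" "\<beta> < pi" and \<gamma>: "0 < \<gamma>" "\<gamma> < pi" "\<beta> + \<gamma> \<le> 3 * pi / 2"
  shows False
proof -
  define D where "D = z * F'"
  have D0: "cmod D > 0" using D by (auto simp: D_def)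
  have dir: "cmod (D * u) * cos \<beta> \<le> Re (D * u)" if u: "Re u < 0" for u
  proof (rule tendsto_le)
    have lim: "((\<lambda>t. F (z * (1 + of_real t * u)) / of_real t) \<longlongrightarrow> D * u) (at_right 0)"
      using directional_difference_quotient_tendsto[OF der, of u] Fz by (simp add: D_def)
    show "((\<lambda>t. cmod (F (z * (1 + of_real t * u)) / of_real t) * cos \<beta>)
        \<longlongrightarrow> cmod (D * u) * cos \<beta>) (at_right 0)"
      by (intro tendsto_intros lim)
    show "((\<lambda>t. Re (F (z * (1 + of_real t * u)) / of_real t)) \<longlongrightarrow> Re (D * u)) (at_right 0)"
      by (intro tendsto_intros lim)
    show "\<forall>\<^sub>F t in at_right 0. cmod (F (z * (1 + of_real t * u)) / of_real t) * cos \<beta>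
        \<le> Re (F (z * (1 + of_real t * u)) / of_real t)"
      using eventually_inward_in_ball[OF z u] eventually_at_right_less[of 0]
    proof eventually_elim
      case (elim t)
      then show ?case
        using ins[of "z * (1 + of_real t * u)"] by (simp add: norm_divide divide_right_mono)
    qed
  qed simp
  \<comment> \<open>The tangential directions are limits of the inward directions v - e.\<close>
  have tangent: "cmod D * cos \<beta> \<le> Re (D * v)" if "v = \<i> \<or> v = - \<i>" for v
  proof (rule tendsto_le)
    have "((\<lambda>e. cmod (D * (v - of_real e)) * cos \<beta>) \<longlongrightarrow> cmod (D * (v - of_real 0)) * cos \<beta>) (at_right 0)"
      by (intro tendsto_intros)
    then show "((\<lambda>e. cmod (D * (v - of_real e)) * cos \<beta>) \<longlongrightarrow> cmod D * cos \<beta>) (at_right 0)"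
      using that by (auto simp: norm_mult)
    have "((\<lambda>e. Re (D * (v - of_real e))) \<longlongrightarrow> Re (D * (v - of_real 0))) (at_right 0)"
      by (intro tendsto_intros)
    then show "((\<lambda>e. Re (D * (v - of_real e))) \<longlongrightarrow> Re (D * v)) (at_right 0)" by simp
    show "\<forall>\<^sub>F e in at_right 0. cmod (D * (v - of_real e)) * cos \<beta> \<le> Re (D * (v - of_real e))"
      using eventually_at_right_less[of 0]
      by eventually_elim (rule dir, use that in auto)
  qed simp
  have Im: "\<bar>Im D\<bar> \<le> - (cmod D * cos \<beta>)"
    using tangent[of \<i>] tangent[of "- \<i>"] by (auto simp: abs_le_iff)
  then have "cmod D * cos \<beta> \<le> 0" by linarith
  then have "cos \<beta> \<le> 0" using D0 by (simp add: mult_le_0_iff)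
  \<comment> \<open>This places 3 pi/2 - \<beta> in [0, pi], where cosine is monotone.\<close>
  then have "\<beta> \<ge> pi / 2" using cos_gt_zero_pi[of \<beta>] \<beta> by (auto simp: not_le[symmetric])
  then have "cos (3 * pi / 2 - \<beta>) \<le> cos \<gamma>" using \<beta> \<gamma> by (intro cos_monotone_0_pi_le) auto
  moreover have "cos (3 * pi / 2 - \<beta>) = - sin \<beta>"
    using cos_periodic_pi2[of "pi / 2 - \<beta>"] cos_sin_eq[of "pi/2 - \<beta>"]
    by (simp add: algebra_simps cos_diff)
  ultimately have "cmod D * - sin \<beta> \<le> cmod D * cos \<gamma>"
    by (intro mult_left_mono) auto
  then have gt: "- (cmod D * sin \<beta>) < Re D" using D by (simp add: D_def)
  have "(Im D)\<^sup>2 \<le> (cmod D * cos \<beta>)\<^sup>2"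
    using power_mono[OF Im, of 2] by simp
  then have "(cmod D * sin \<beta>)\<^sup>2 \<le> (Re D)\<^sup>2"
    by (simp add: power_mult_distrib sin_squared_eq right_diff_distrib cmod_power2)
  then have "\<bar>cmod D * sin \<beta>\<bar> \<le> \<bar>Re D\<bar>" by (simp only: abs_le_square_iff)
  moreover have pos: "cmod D * sin \<beta> > 0" using D0 \<beta> by (simp add: sin_gt_zero)
  ultimately have "Re D > 0" using gt by linarith
  \<comment> \<open>Now \<open>- cnj D\<close> points inward, and its image -|D|^2 is a negative
    real, outside the closed sector.\<close>
  then have "cmod (D * - cnj D) * cos \<beta> \<le> Re (D * - cnj D)" by (intro dir) simp
  then have "(cmod D)\<^sup>2 * cos \<beta> \<le> (cmod D)\<^sup>2 * - 1"
    by (simp add: norm_mult power2_eq_square[of "cmod D"] cmod_power2[unfolded power2_eq_square] )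
  then have "cos \<beta> \<le> - 1" by (rule mult_left_le_imp_le) (use D0 in simp)
  moreover have "cos \<beta> > cos pi" using \<beta> by (intro cos_monotone_0_pi) auto
  ultimately show False by simp
qed

text \<open>The power (F/c)^(1/\<alpha>) maps into the right half-plane, is 1 at the origin and is
  imaginary at \<open>z\<close>. The half-plane lemma makes z F'/F imaginary of modulus T >=
  \<alpha>, so k F + z F' = F (k + z F'/F) is turned away from the positive axis by at least
  arctan(\<alpha>/k) beyond the edge, against \<open>val\<close>.\<close>

lemma sector_boundary_ray_contradiction:
  fixes F :: "complex \<Rightarrow> complex"
  assumes z: "z \<noteq> 0" and hol: "F holomorphic_on ball 0 (cmod z)"
    and F0: "F 0 = of_real c" "c > 0"
    and der: "(F has_field_derivative F') (at z)" and Fz: "F z \<noteq> 0"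
    and bd: "\<bar>Arg (F z)\<bar> = \<alpha> * pi / 2"
    and ins: "\<And>w. cmod w < cmod z \<Longrightarrow> abs_arg_less (F w) (\<alpha> * pi / 2)"
    and \<alpha>: "0 < \<alpha>" "\<alpha> < 2" and k: "0 < k"
    and \<gamma>: "\<gamma> = \<alpha> * pi / 2 + arctan (\<alpha> / k)" "\<alpha> * pi / 2 + \<gamma> \<le> 3 * pi / 2"
    and val: "cmod (of_real k * F z + z * F') * cos \<gamma> < Re (of_real k * F z + z * F')"
  shows False
proof -
  define \<beta> where "\<beta> = \<alpha> * pi / 2"
  have \<beta>: "0 < \<beta>" "\<beta> < pi" using \<alpha> by (auto simp: \<beta>_def)
  \<comment> \<open>The closed sector without its vertex avoids the branch cut of \<open>Ln\<close>,
    so the power is differentiable at \<open>z\<close> too.\<close>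
  have slit: "w \<notin> \<real>\<^sub>\<le>\<^sub>0" if "w \<noteq> 0" "\<bar>Arg w\<bar> \<le> \<beta>" for w
  proof
    assume "w \<in> \<real>\<^sub>\<le>\<^sub>0"
    then have "Arg w = pi" using that(1) by (simp add: Arg_eq_pi complex_nonpos_Reals_iff complex_eq_iff)
    then show False using that(2) \<beta> by simp
  qed
  have ins': "F w \<noteq> 0" "\<bar>Arg (F w)\<bar> < \<beta>" if "cmod w < cmod z" for w
    using ins[OF that] by (auto simp: abs_arg_less_def \<beta>_def)
  define h where "h = (\<lambda>w. (Ln (F w) - of_real (ln c)) / of_real \<alpha>)"
  have Imh: "Im (h w) = Arg (F w) / \<alpha>" if "F w \<noteq> 0" for w
    using that by (simp add: h_def Arg_eq_Im_Ln)
  \<comment> \<open>The sign tells the upper edge from the lower one, so that both are treated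
    together.\<close>
  obtain \<epsilon> :: real where \<epsilon>: "\<epsilon> = 1 \<or> \<epsilon> = - 1" and Arg: "Arg (F z) = \<epsilon> * \<beta>"
    using bd[folded \<beta>_def] \<beta> by (metis abs_if mult_1 mult_minus1 minus_minus)
  define a where "a = exp (Re (h z))"
  have a: "a > 0" by (simp add: a_def)
  have "Im (h z) = \<epsilon> * (pi / 2)" using \<alpha> Imh[OF Fz] Arg by (simp add: \<beta>_def)
  then have "Im (h z) = pi / 2 \<and> \<epsilon> = 1 \<or> Im (h z) = - (pi / 2) \<and> \<epsilon> = - 1"
    using \<epsilon> by auto
  then have "cos (Im (h z)) = 0" "sin (Im (h z)) = \<epsilon>"
    by (elim disjE conjE; simp only: cos_minus sin_minus cos_pi_half sin_pi_half)+
  then have gz: "exp (h z) = \<i> * of_real (\<epsilon> * a)"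
    using \<epsilon> by (auto simp: a_def complex_eq_iff Re_exp Im_exp)
  obtain m where m: "m \<ge> 1"
    "z * (exp (h z) * (inverse (F z) * F' / of_real \<alpha>)) = - of_real (m * (1 + (\<epsilon> * a)\<^sup>2) / 2)"
  proof (rule Caratheodory_boundary[OF z, where g = "\<lambda>w. exp (h w)"])
    show "(\<lambda>w. exp (h w)) holomorphic_on ball 0 (cmod z)"
      unfolding h_def using slit ins' \<alpha>
      by (intro holomorphic_intros hol) (auto simp: less_imp_le)
    show "exp (h 0) = 1" using F0 by (simp add: h_def Ln_of_real)
    show "((\<lambda>w. exp (h w)) has_field_derivative
        exp (h z) * (inverse (F z) * F' / of_real \<alpha>)) (at z)"
      unfolding h_def using slit[OF Fz] bd \<alpha>
      by (auto intro!: derivative_eq_intros der simp: \<beta>_def)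
    show "0 < Re (exp (h w))" if "cmod w < cmod z" for w
    proof -
      have "\<bar>Im (h w)\<bar> < pi / 2"
        using ins'[OF that] \<alpha> by (simp add: Imh abs_divide \<beta>_def pos_divide_less_eq mult.commute)
      then have "cos (Im (h w)) > 0" by (intro cos_gt_zero_pi) linarith+
      then show ?thesis by (simp add: Re_exp)
    qed
    show "exp (h z) = \<i> * of_real (\<epsilon> * a)" by (rule gz)
  qed
  have \<epsilon>2: "\<epsilon> * \<epsilon> = 1" using \<epsilon> by auto
  \<comment> \<open>This is \<alpha> m (a + 1/a)/2, hence at least \<alpha>, because m >= 1 and a +
    1/a >= 2.\<close>
  define T where "T = \<alpha> * (m * (1 + a\<^sup>2) / (2 * a))"
  have "2 * a \<le> 1 + a\<^sup>2" using sum_squares_bound[of a 1] by simp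
  then have "1 \<le> (1 + a\<^sup>2) / (2 * a)" using a by simp
  then have "1 * 1 \<le> m * ((1 + a\<^sup>2) / (2 * a))" using m(1) by (intro mult_mono) auto
  then have "\<alpha> * 1 \<le> T" unfolding T_def using \<alpha> by (intro mult_left_mono) auto
  then have T: "\<alpha> \<le> T" by simp
  have zF: "z * F' = F z * (\<i> * of_real (\<epsilon> * T))"
  proof -
    have "z * F' * (\<i> * of_real (\<epsilon> * a)) = - (of_real (\<alpha> * (m * (1 + a\<^sup>2) / 2)) * F z)"
      using m(2) Fz \<alpha> gz \<epsilon>2
      by (simp add: field_simps power_mult_distrib power2_eq_square[of \<epsilon>])
    also have "\<dots> = F z * (\<i> * of_real (\<epsilon> * T)) * (\<i> * of_real (\<epsilon> * a))"
    proof -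
      have "\<i> * of_real (\<epsilon> * T) * (\<i> * of_real (\<epsilon> * a)) = - complex_of_real ((\<epsilon> * \<epsilon>) * (T * a))"
        by (simp add: algebra_simps)
      also have "T * a = \<alpha> * (m * (1 + a\<^sup>2) / 2)" using a by (simp add: T_def)
      finally show ?thesis using \<epsilon>2 by (simp add: mult.assoc)
    qed
    finally show ?thesis using a \<epsilon> by auto
  qed
  define \<phi> where "\<phi> = arctan (T / k)"
  have \<phi>: "arctan (\<alpha> / k) \<le> \<phi>" "\<phi> < pi / 2" "0 < cos \<phi>"
    using T k arctan_ubound[of "T / k"] arctan_lbound[of "T / k"] unfolding \<phi>_def
    by (auto simp: arctan_le_iff divide_right_mono intro!: cos_gt_zero_pi)
  have lin: "of_real k + \<i> * of_real (\<epsilon> * T) = of_real (k / cos \<phi>) * cis (\<epsilon> * \<phi>)"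
  proof -
    have "sin \<phi> / cos \<phi> = T / k" using tan_arctan[of "T / k"] by (simp add: \<phi>_def tan_def)
    then have "k * sin \<phi> / cos \<phi> = T" using k \<phi> by (simp add: field_simps)
    then show ?thesis using \<phi> \<epsilon> by (auto simp: complex_eq_iff)
  qed
  have "F z = of_real (cmod (F z)) * cis (\<epsilon> * \<beta>)"
    using rcis_cmod_Arg[of "F z"] Arg by (simp add: rcis_def)
  then have "of_real k * F z + z * F'
      = of_real (cmod (F z)) * cis (\<epsilon> * \<beta>) * (of_real (k / cos \<phi>) * cis (\<epsilon> * \<phi>))"
    using zF lin by (metis distrib_left mult.commute)
  also have "\<dots> = of_real (cmod (F z) * (k / cos \<phi>)) * cis (\<epsilon> * (\<beta> + \<phi>))"
    by (simp add: distrib_left cis_mult[symmetric] mult_ac)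
  finally obtain \<rho> where \<rho>: "\<rho> = cmod (F z) * (k / cos \<phi>)"
    and V: "of_real k * F z + z * F' = of_real \<rho> * cis (\<epsilon> * (\<beta> + \<phi>))"
    by blast
  have pos: "\<rho> > 0" unfolding \<rho> using Fz k \<phi> by simp
  have "cos (\<epsilon> * (\<beta> + \<phi>)) = cos (\<beta> + \<phi>)" using \<epsilon> cos_minus[of "\<beta> + \<phi>"] by auto
  then have "\<rho> * cos \<gamma> < \<rho> * cos (\<beta> + \<phi>)" using val pos unfolding V by (simp add: norm_mult)
  then have "cos \<gamma> < cos (\<beta> + \<phi>)" using pos by simp
  \<comment> \<open>The angle \<beta> + \<phi> may pass pi; then 2 pi - (\<beta> + \<phi>) is
    compared with \<gamma> instead. It is at least \<gamma> since \<phi> < pi/2 and \<beta> +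
    \<gamma> <= 3 pi/2.\<close>
  moreover have "cos (\<beta> + \<phi>) \<le> cos \<gamma>"
  proof -
    have at_pos: "0 < arctan (\<alpha> / k)" using \<alpha> k by (simp add: zero_less_arctan_iff)
    have "0 < \<gamma>" "\<gamma> \<le> \<beta> + \<phi>" "\<gamma> \<le> 2 * pi - (\<beta> + \<phi>)"
      using \<gamma>[folded \<beta>_def] \<phi> \<beta> at_pos by linarith+
    then have "\<beta> + \<phi> \<le> pi \<Longrightarrow> cos (\<beta> + \<phi>) \<le> cos \<gamma>"
      "pi < \<beta> + \<phi> \<Longrightarrow> cos (2 * pi - (\<beta> + \<phi>)) \<le> cos \<gamma>"
      by (intro cos_monotone_0_pi_le; linarith)+
    then show ?thesis by (cases "\<beta> + \<phi> \<le> pi") (auto simp: cos_2pi_minus)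
  qed
  ultimately show False by simp
qed

text \<open>This is one step of the induction: \<open>F 0\<close> is positive and so lies inside the
  sector, and a first exit, through the vertex or through an edge, is excluded by the two preceding
  lemmas.\<close>

lemma Nunokawa_sector:
  fixes F :: "complex \<Rightarrow> complex"
  assumes hol: "F holomorphic_on ball 0 1" and F0: "F 0 = of_real c" "c > 0"
    and \<alpha>: "0 < \<alpha>" "\<alpha> < 2" and k: "0 < k"
    and \<gamma>: "\<gamma> = \<alpha> * pi / 2 + arctan (\<alpha> / k)" "\<alpha> * pi / 2 + \<gamma> \<le> 3 * pi / 2"
    and val: "\<And>z. cmod z < 1 \<Longrightarrow> abs_arg_less (of_real k * F z + z * deriv F z) \<gamma>"
    and z: "cmod z < 1"
  shows "abs_arg_less (F z) (\<alpha> * pi / 2)"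
proof (rule ccontr)
  define \<beta> where "\<beta> = \<alpha> * pi / 2"
  have \<beta>: "0 < \<beta>" "\<beta> < pi" using \<alpha> by (auto simp: \<beta>_def)
  have at: "0 < arctan (\<alpha> / k)" "arctan (\<alpha> / k) < pi / 2"
    using \<alpha> k arctan_ubound[of "\<alpha> / k"] by auto
  \<comment> \<open>For the upper bound, 2 \<gamma> = (\<beta> + \<gamma>) + arctan(\<alpha>/k) < 3
    pi/2 + pi/2.\<close>
  have \<gamma>': "0 < \<gamma>" "\<gamma> < pi" "\<beta> + \<gamma> \<le> 3 * pi / 2"
    using \<gamma>[folded \<beta>_def] \<beta> at by linarith+
  note sector = abs_arg_less_iff_sector[OF \<beta>(1) less_imp_le[OF \<beta>(2)]]
  assume bad: "\<not> abs_arg_less (F z) (\<alpha> * pi / 2)"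
  \<comment> \<open>The points where \<open>F\<close> is outside the open sector form a compact set,
    so one of least modulus exists.\<close>
  define B where "B = {w \<in> cball 0 (cmod z). Re (F w) - cmod (F w) * cos \<beta> \<in> {..0}}"
  have sub: "cball 0 (cmod z) \<subseteq> ball 0 1" using z by auto
  have cont: "continuous_on (ball 0 1) F" using hol by (rule holomorphic_on_imp_continuous_on)
  have "continuous_on (cball 0 (cmod z)) (\<lambda>w. Re (F w) - cmod (F w) * cos \<beta>)"
    by (intro continuous_intros continuous_on_subset[OF cont sub])
  then have "closed B" unfolding B_def
    using continuous_closed_preimage[of "cball 0 (cmod z)" "\<lambda>w. Re (F w) - cmod (F w) * cos \<beta>" "{..0}"]
    by (simp add: vimage_def Int_def)
  moreover have "z \<in> B" using bad sector[of "F z"] by (auto simp: B_def \<beta>_def not_less)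
  moreover have "bounded B" by (rule bounded_subset[OF bounded_cball[of 0 "cmod z"]]) (auto simp: B_def)
  ultimately obtain y where y: "y \<in> B" "\<And>w. w \<in> B \<Longrightarrow> cmod y \<le> cmod w"
    using continuous_attains_inf[of B cmod] continuous_on_norm_id compact_eq_bounded_closed by blast
  have y1: "cmod y < 1" using y(1) z by (auto simp: B_def)
  have ins: "abs_arg_less (F w) \<beta>" if "cmod w < cmod y" for w
    using y(2)[of w] that y(1) sector[of "F w"] by (auto simp: B_def not_less[symmetric])
  have ynb: "Re (F y) \<le> cmod (F y) * cos \<beta>" using y(1) by (simp add: B_def)
  have y0: "y \<noteq> 0"
  proof
    assume "y = 0"
    then have "c \<le> c * cos \<beta>" using ynb F0 by simp
    moreover have "cos \<beta> < cos 0" using \<beta> by (intro cos_monotone_0_pi) auto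
    ultimately show False using F0 by simp
  qed
  have der: "(F has_field_derivative deriv F y) (at y)"
    using hol y1 by (intro holomorphic_derivI[of _ "ball 0 1"]) auto
  have val': "cmod (of_real k * F y + y * deriv F y) * cos \<gamma> < Re (of_real k * F y + y * deriv F y)"
    using val[OF y1] abs_arg_less_iff_sector[of \<gamma>] \<gamma>' by simp
  show False
  proof (cases "F y = 0")
    case True
    show False
      by (rule sector_boundary_zero_contradiction[OF y0 der True _ _ \<beta> \<gamma>'])
        (use ins sector val' True in auto)
  next
    case False
    \<comment> \<open>Radial approach to \<open>y\<close> keeps \<open>F y\<close> in the closed
      sector; with \<open>ynb\<close> it lies on the edge.\<close>
    have "cmod (F y) * cos \<beta> \<le> Re (F y)"
    proof (rule tendsto_le)
      have "((\<lambda>t. y * (1 + complex_of_real t * (- 1))) \<longlongrightarrow> y * (1 + of_real 0 * (- 1))) (at_right 0)"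
        by (intro tendsto_intros)
      then have lim: "((\<lambda>t. F (y * (1 + of_real t * (- 1)))) \<longlongrightarrow> F y) (at_right 0)"
        using isCont_tendsto_compose[OF DERIV_isCont[OF der]] by simp
      show "((\<lambda>t. cmod (F (y * (1 + of_real t * (- 1)))) * cos \<beta>) \<longlongrightarrow> cmod (F y) * cos \<beta>) (at_right 0)"
        by (intro tendsto_intros lim)
      show "((\<lambda>t. Re (F (y * (1 + of_real t * (- 1))))) \<longlongrightarrow> Re (F y)) (at_right 0)"
        by (intro tendsto_intros lim)
      show "\<forall>\<^sub>F t in at_right 0. cmod (F (y * (1 + of_real t * (- 1)))) * cos \<beta>
          \<le> Re (F (y * (1 + of_real t * (- 1))))"
      proof -
        have "\<forall>\<^sub>F t in at_right 0. y * (1 + of_real t * (- 1)) \<in> ball 0 (cmod y)"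
          using y0 by (intro eventually_inward_in_ball) auto
        then show ?thesis
          by eventually_elim (use ins sector in \<open>auto intro: less_imp_le\<close>)
      qed
    qed simp
    with ynb have "cmod (F y) * cos \<beta> = Re (F y)" by simp
    also have "\<dots> = cmod (F y) * cos \<bar>Arg (F y)\<bar>"
      using Re_rcis[of "cmod (F y)" "Arg (F y)"] rcis_cmod_Arg by simp
    finally have eq: "cos \<bar>Arg (F y)\<bar> = cos \<beta>" using False by simp
    have "\<bar>Arg (F y)\<bar> = \<beta>"
      by (rule cos_inj_pi[OF _ _ _ _ eq]) (use \<beta> Arg_bounded[of "F y"] in auto)
    then show False
      using sector_boundary_ray_contradiction[OF y0 _ F0 der False _ _ \<alpha> k \<gamma> val']
        holomorphic_on_subset[OF hol, of "ball 0 (cmod y)"] y1 ins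
      by (simp add: \<beta>_def subset_ball)
  qed
qed

text \<open>If a + b <= pi, the difference of the principal arguments is again principal; otherwise
  the bound exceeds pi and holds automatically.\<close>

lemma abs_arg_less_divide:
  assumes "abs_arg_less u a" "abs_arg_less v b"
  shows "abs_arg_less (u / v) (a + b)"
proof (cases "a + b \<le> pi")
  case True
  have uv: "u \<noteq> 0" "v \<noteq> 0" "\<bar>Arg u\<bar> < a" "\<bar>Arg v\<bar> < b" using assms by (auto simp: abs_arg_less_def)
  then have "Arg (u / v) = Arg u - Arg v"
  proof -
    have "Arg (rcis (cmod u / cmod v) (Arg u - Arg v)) = Arg u - Arg v"
      using uv True by (intro Arg_rcis) auto
    moreover have "rcis (cmod u / cmod v) (Arg u - Arg v) = u / v"
      using rcis_divide[of "cmod u" "Arg u" "cmod v" "Arg v"] by (simp add: rcis_cmod_Arg)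
    ultimately show ?thesis by simp
  qed
  then show ?thesis using uv by (auto simp: abs_arg_less_def)
next
  case False
  then show ?thesis using assms Arg_bounded[of "u / v"] by (auto simp: abs_arg_less_def)
qed

section \<open>Cofactors of the powers of z in f and its derivatives\<close>

lemma pvalent_normalized_factor:
  assumes "pvalent_normalized p f"
  obtains G where "G holomorphic_on ball 0 1" "G 0 = 1" "\<And>z. cmod z < 1 \<Longrightarrow> f z = z ^ p * G z"
proof -
  obtain a :: "nat \<Rightarrow> complex" where
    a: "\<And>z. cmod z < 1 \<Longrightarrow> (\<lambda>n. a (p + 1 + n) * z ^ (p + 1 + n)) sums (f z - z ^ p)"
    using assms unfolding pvalent_normalized_def by (metis mem_ball_0)
  define R where "R = (\<lambda>z. \<Sum>n. a (p + 1 + n) * z ^ n)"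
  have sm: "summable (\<lambda>n. a (p + 1 + n) * z ^ n)" if "cmod z < 1" for z
  proof (cases "z = 0")
    case False
    have "summable (\<lambda>n. a (p + 1 + n) * z ^ (p + 1 + n) / z ^ (p + 1))"
      using a[OF that] by (intro summable_divide) (rule sums_summable)
    moreover have "a (p + 1 + n) * z ^ (p + 1 + n) / z ^ (p + 1) = a (p + 1 + n) * z ^ n" for n
      using False by (simp add: power_add)
    ultimately show ?thesis by simp
  qed (use powser_sums_zero[THEN sums_summable] in simp)
  show ?thesis
  proof (rule that[of "\<lambda>z. 1 + z * R z"])
    have "R holomorphic_on ball 0 1"
    proof (rule power_series_holomorphic)
      show "(\<lambda>n. a (p + 1 + n) * (w - 0) ^ n) sums R w" if "w \<in> ball 0 1" for w
        using summable_sums[OF sm[of w]] that by (simp only: R_def diff_zero mem_ball_0)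
    qed
    then show "(\<lambda>z. 1 + z * R z) holomorphic_on ball 0 1" by (intro holomorphic_intros)
    show "1 + 0 * R 0 = 1" by simp
    show "f z = z ^ p * (1 + z * R z)" if "cmod z < 1" for z
    proof -
      have "(\<lambda>n. z ^ (p + 1) * (a (p + 1 + n) * z ^ n)) sums (z ^ (p + 1) * R z)"
        unfolding R_def by (intro sums_mult summable_sums sm that)
      then have "(\<lambda>n. a (p + 1 + n) * z ^ (p + 1 + n)) sums (z ^ (p + 1) * R z)"
        by (simp add: power_add mult_ac)
      then have "f z - z ^ p = z ^ (p + 1) * R z" using a[OF that] sums_unique2 by blast
      then show ?thesis by (simp add: algebra_simps)
    qed
  qed
qed

text \<open>The cofactor of z^(p-j) in the j-th derivative of z^p G, for j <= p, by the product
  rule. The recursion involves no division, so the origin is not exceptional. The overview's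
  \<open>F\<^sub>k\<close> is the case j = p - k.\<close>

fun derivative_factor :: "nat \<Rightarrow> (complex \<Rightarrow> complex) \<Rightarrow> nat \<Rightarrow> complex \<Rightarrow> complex" where
  "derivative_factor p G 0 = G"
| "derivative_factor p G (Suc j) =
     (\<lambda>z. of_nat (p - j) * derivative_factor p G j z + z * deriv (derivative_factor p G j) z)"

lemma derivative_factor_holomorphic:
  assumes "G holomorphic_on ball 0 1"
  shows "derivative_factor p G j holomorphic_on ball 0 1"
  by (induction j) (simp_all add: assms holomorphic_on_add holomorphic_on_mult holomorphic_deriv)

text \<open>At the origin the recursion only multiplies by p - j > 0. The positive value there is
  the starting point for the sector argument.\<close>

lemma derivative_factor_0:
  assumes "G 0 = 1" "j \<le> p"
  shows "\<exists>c>0. derivative_factor p G j 0 = complex_of_real c"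
  using assms(2)
proof (induction j)
  case 0
  then show ?case using assms by (auto intro!: exI[of _ 1])
next
  case (Suc j)
  then obtain c where "c > 0" "derivative_factor p G j 0 = complex_of_real c" by auto
  then show ?case using Suc.prems by (auto intro!: exI[of _ "real (p - j) * c"])
qed

lemma higher_deriv_factor:
  assumes hol: "G holomorphic_on ball 0 1"
    and fac: "\<And>z. cmod z < 1 \<Longrightarrow> f z = z ^ p * G z"
  shows "j \<le> p \<Longrightarrow> cmod z < 1 \<Longrightarrow> (deriv ^^ j) f z = z ^ (p - j) * derivative_factor p G j z"
proof (induction j arbitrary: z)
  case (Suc j)
  have "(derivative_factor p G j has_field_derivative deriv (derivative_factor p G j) z) (at z)"
    using derivative_factor_holomorphic[OF hol] Suc.prems
    by (intro holomorphic_derivI[of _ "ball 0 1"]) auto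
  then have der: "((\<lambda>z. z ^ (p - j) * derivative_factor p G j z) has_field_derivative
      of_nat (p - j) * z ^ (p - j - 1) * derivative_factor p G j z
        + z ^ (p - j) * deriv (derivative_factor p G j) z) (at z)"
    by (auto intro!: derivative_eq_intros)
  have "\<forall>\<^sub>F w in nhds z. w \<in> ball 0 1" using Suc.prems by (intro eventually_nhds_in_open) auto
  then have "\<forall>\<^sub>F w in nhds z. (deriv ^^ j) f w = w ^ (p - j) * derivative_factor p G j w"
    by eventually_elim (use Suc in auto)
  then have "(deriv ^^ Suc j) f z = deriv (\<lambda>z. z ^ (p - j) * derivative_factor p G j z) z"
    by (simp add: deriv_cong_ev)
  also have "\<dots> = of_nat (p - j) * z ^ (p - j - 1) * derivative_factor p G j z
        + z ^ (p - j) * deriv (derivative_factor p G j) z"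
    using der by (rule DERIV_imp_deriv)
  also have "z ^ (p - j) = z ^ (p - Suc j) * z"
    using Suc.prems by (metis Suc_diff_le diff_Suc_Suc power_Suc2)
  finally show ?case by (simp add: algebra_simps)
qed (use fac in auto)

text \<open>The common power of z cancels away from the origin, and
  \<open>H\<close>/\<open>F\<close> is analytic at 0 because \<open>F\<close> has no zeros; hence it
  is the required extension.\<close>

lemma abs_arg_quotient_less_power_factor:
  assumes F: "F holomorphic_on ball 0 1" "\<And>w. cmod w < 1 \<Longrightarrow> F w \<noteq> 0"
    and H: "H holomorphic_on ball 0 1"
    and g: "\<And>w. cmod w < 1 \<Longrightarrow> g w = w ^ s * H w" and h: "\<And>w. cmod w < 1 \<Longrightarrow> h w = w ^ s * F w"
    and z: "cmod z < 1" and arg: "abs_arg_less (H z / F z) c"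
  shows "abs_arg_quotient_less g h z c"
proof (cases "z = 0")
  case False
  then show ?thesis
    using F(2)[OF z] g[OF z] h[OF z] arg
    by (simp add: abs_arg_quotient_less_def ext_quotient_defined_def ext_quotient_def)
next
  case True
  have an: "(\<lambda>w. H w / F w) analytic_on {0}"
    using F H by (intro analytic_on_divide)
      (auto intro!: analytic_on_subset[of _ "ball 0 1" "{0}"] simp: analytic_on_open)
  have "\<forall>\<^sub>F w in at 0. w \<in> ball 0 (1::real) - {0::complex}"
    by (rule eventually_at_in_open) auto
  then have ev: "\<forall>\<^sub>F w in at 0. h w \<noteq> 0 \<and> H w / F w = g w / h w"
    by eventually_elim (use F(2) g h in auto)
  have "(\<lambda>w. H w / F w) \<midarrow>0\<rightarrow> H 0 / F 0"
    using analytic_at_imp_isCont[OF an] by (simp add: isCont_def)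
  then have "(\<lambda>w. g w / h w) \<midarrow>0\<rightarrow> H 0 / F 0"
    by (rule tendsto_cong[THEN iffD1, rotated]) (use ev in eventually_elim, simp)
  then have "ext_quotient g h 0 = H 0 / F 0" by (simp add: ext_quotient_def remove_sings_eqI)
  then show ?thesis
    using an ev arg True by (auto simp: abs_arg_quotient_less_def ext_quotient_defined_def)
qed

theorem theorem2p5:
  fixes p :: nat and f :: "complex \<Rightarrow> complex" and \<alpha> :: "nat \<Rightarrow> real"
  assumes "p \<ge> 1"
    and "pvalent_normalized p f"
    and "0 < \<alpha> 0" and "\<alpha> 0 \<le> 3 / 2"
    and "\<forall>z\<in>ball 0 1. abs_arg_less ((deriv ^^ p) f z) (pi * \<alpha> 0 / 2)"
    and "\<forall>k\<in>{1..p}. \<alpha> k + 2 / pi * arctan (\<alpha> k / real k) = \<alpha> (k - 1)"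
  shows "(\<forall>s\<in>{2..p}. \<forall>z\<in>ball 0 1.
            abs_arg_quotient_less (\<lambda>w. w * (deriv ^^ (p - s + 1)) f w) ((deriv ^^ (p - s)) f) z
              (pi / 2 * (\<alpha> s + \<alpha> (s - 1)))) \<and>
         ((\<exists>\<sigma>\<in>{2..p}. \<alpha> \<sigma> + \<alpha> (\<sigma> - 1) \<le> 1) \<longrightarrow>
            (\<forall>z\<in>ball 0 1.
               abs_arg_quotient_less (\<lambda>w. w * deriv f w) f z (pi * (\<alpha> (p - 1) + \<alpha> p) / 2)) \<and>
            pi * (\<alpha> (p - 1) + \<alpha> p) / 2 \<le> pi / 2 \<and>
            strongly_starlike p (\<alpha> (p - 1) + \<alpha> p) f)"
proof -
  have rec: "\<alpha> (Suc k) + 2 / pi * arctan (\<alpha> (Suc k) / real (Suc k)) = \<alpha> k" if "Suc k \<le> p" for k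
    using assms(6) that by force
  \<comment> \<open>The arctangent has the sign of its argument, so both summands of the recursion
    share the sign of their sum.\<close>
  have pos_step: "0 < \<alpha> (Suc k) \<and> \<alpha> (Suc k) < \<alpha> k" if "Suc k \<le> p" "0 < \<alpha> k" for k
  proof -
    have "0 < \<alpha> (Suc k)"
    proof (rule ccontr)
      assume "\<not> 0 < \<alpha> (Suc k)"
      then have "arctan (\<alpha> (Suc k) / real (Suc k)) \<le> 0" "\<alpha> (Suc k) \<le> 0"
        by (auto simp: divide_nonpos_pos)
      then have "\<alpha> (Suc k) + 2 / pi * arctan (\<alpha> (Suc k) / real (Suc k)) \<le> 0"
        by (intro add_nonpos_nonpos mult_nonneg_nonpos) auto
      then show False using rec[OF that(1)] that(2) by simp
    qed
    moreover from this have "2 / pi * arctan (\<alpha> (Suc k) / real (Suc k)) > 0" by simp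
    ultimately show ?thesis using rec[OF that(1)] by linarith
  qed
  have pos: "0 < \<alpha> k" if "k \<le> p" for k
    using that by (induction k) (use assms(3) pos_step in auto)
  have dec: "\<alpha> k \<le> \<alpha> j" if "j \<le> k" "k \<le> p" for j k
    using that
  proof (induction k rule: dec_induct)
    case (step n)
    then show ?case using pos_step[of n] pos[of n] by auto
  qed simp
  obtain G where G: "G holomorphic_on ball 0 1" "G 0 = 1" "\<And>z. cmod z < 1 \<Longrightarrow> f z = z ^ p * G z"
    using pvalent_normalized_factor[OF assms(2)] by blast
  define F where "F = (\<lambda>k. derivative_factor p G (p - k))"
  have F_hol: "F k holomorphic_on ball 0 1" for k
    unfolding F_def by (rule derivative_factor_holomorphic[OF G(1)])
  have F_deriv: "(deriv ^^ (p - k)) f z = z ^ k * F k z" if "k \<le> p" "cmod z < 1" for k z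
    using higher_deriv_factor[OF G(1,3), of "p - k" z] that by (simp add: F_def)
  have F_Suc: "F k z = of_real (real (Suc k)) * F (Suc k) z + z * deriv (F (Suc k)) z"
    if "Suc k \<le> p" for k z
  proof -
    have "p - k = Suc (p - Suc k)" "p - (p - Suc k) = Suc k" using that by auto
    then show ?thesis by (simp add: F_def)
  qed
  have F_arg: "abs_arg_less (F k z) (\<alpha> k * pi / 2)" if "k \<le> p" "cmod z < 1" for k z
    using that
  proof (induction k arbitrary: z)
    case 0
    then show ?case using bspec[OF assms(5), of z] F_deriv[of 0 z] by (simp add: mult.commute)
  next
    case (Suc k)
    obtain c where c: "c > 0" "F (Suc k) 0 = of_real c"
      using derivative_factor_0[of G "p - Suc k" p] G(2) by (auto simp: F_def)
    have ak: "0 < \<alpha> (Suc k)" "\<alpha> (Suc k) \<le> 3 / 2" "\<alpha> k \<le> 3 / 2"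
      using pos[of "Suc k"] dec[of 0 "Suc k"] dec[of 0 k] assms(4) Suc.prems by auto
    \<comment> \<open>The recursion times pi/2 is exactly the relation between the two half-angles
      in the sector lemma.\<close>
    have eq: "\<alpha> k * pi / 2 = \<alpha> (Suc k) * pi / 2 + arctan (\<alpha> (Suc k) / real (Suc k))"
      unfolding rec[OF Suc.prems(1), symmetric] by (simp add: distrib_right add_divide_distrib)
    have "(\<alpha> (Suc k) + \<alpha> k) * pi \<le> 3 * pi" using ak by (intro mult_right_mono) auto
    then have le: "\<alpha> (Suc k) * pi / 2 + \<alpha> k * pi / 2 \<le> 3 * pi / 2" by (simp add: field_simps)
    show ?case
    proof (rule Nunokawa_sector[OF F_hol c(2,1) _ _ _ eq le])
      show "abs_arg_less (of_real (real (Suc k)) * F (Suc k) w + w * deriv (F (Suc k)) w) (\<alpha> k * pi / 2)"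
        if "cmod w < 1" for w
        using Suc.IH[OF _ that] F_Suc[of k w] Suc.prems by simp
    qed (use ak Suc.prems in auto)
  qed
  have quot: "abs_arg_quotient_less (\<lambda>w. w * (deriv ^^ (p - s + 1)) f w) ((deriv ^^ (p - s)) f) z
      (pi / 2 * (\<alpha> s + \<alpha> (s - 1)))" if s: "s \<in> {2..p}" and z: "cmod z < 1" for s z
  proof (rule abs_arg_quotient_less_power_factor[OF F_hol[of s] _ F_hol[of "s - 1"] _ _ z])
    show "F s w \<noteq> 0" if "cmod w < 1" for w
      using F_arg[OF _ that, of s] s by (auto simp: abs_arg_less_def)
    show "w * (deriv ^^ (p - s + 1)) f w = w ^ s * F (s - 1) w" if "cmod w < 1" for w
    proof -
      have "p - s + 1 = p - (s - 1)" using s by auto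
      moreover have "w ^ s = w * w ^ (s - 1)"
        using s power_minus_mult[of s w] by (auto simp: mult.commute)
      ultimately show ?thesis using F_deriv[OF _ that, of "s - 1"] s by simp
    qed
    show "(deriv ^^ (p - s)) f w = w ^ s * F s w" if "cmod w < 1" for w
      using F_deriv[OF _ that, of s] s by simp
    have "abs_arg_less (F (s - 1) z / F s z) (\<alpha> (s - 1) * pi / 2 + \<alpha> s * pi / 2)"
      using s z by (intro abs_arg_less_divide F_arg) auto
    then show "abs_arg_less (F (s - 1) z / F s z) (pi / 2 * (\<alpha> s + \<alpha> (s - 1)))"
      by (simp add: algebra_simps add_divide_distrib)
  qed
  have starlike: "(\<forall>z\<in>ball 0 1.
        abs_arg_quotient_less (\<lambda>w. w * deriv f w) f z (pi * (\<alpha> (p - 1) + \<alpha> p) / 2)) \<and>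
      pi * (\<alpha> (p - 1) + \<alpha> p) / 2 \<le> pi / 2 \<and> strongly_starlike p (\<alpha> (p - 1) + \<alpha> p) f"
    if "\<sigma> \<in> {2..p}" "\<alpha> \<sigma> + \<alpha> (\<sigma> - 1) \<le> 1" for \<sigma>
  proof -
    \<comment> \<open>Both terms decrease in the index, so the bound at \<sigma> carries over to
      \<open>p\<close>.\<close>
    have le1: "\<alpha> (p - 1) + \<alpha> p \<le> 1"
      using dec[of \<sigma> p] dec[OF diff_le_mono[of \<sigma> p 1]] that by auto
    have q: "abs_arg_quotient_less (\<lambda>w. w * deriv f w) f z (pi * (\<alpha> (p - 1) + \<alpha> p) / 2)"
      if "cmod z < 1" for z
      \<comment> \<open>At s = p the derivatives of orders p - s + 1 and p - s are f' and f.\<close>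
      using quot[of p z] \<open>\<sigma> \<in> {2..p}\<close> that by (simp add: add.commute)
    then have "strongly_starlike p (\<alpha> (p - 1) + \<alpha> p) f"
      using le1 pos[of p] pos[of "p - 1"] assms(2) by (simp add: strongly_starlike_def mult.commute)
    moreover have "pi * (\<alpha> (p - 1) + \<alpha> p) / 2 \<le> pi / 2" using le1 by simp
    ultimately show ?thesis using q by auto
  qed
  show ?thesis using quot starlike by auto
qed

end
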